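(* Let $\tau$ be a non-identity permutation of length at least $3$. Then for every $n\ge 1$, the number of permutations of length $n$ sorted to the identity $12\cdots n$ by $s_{\{213,\tau\}}$ is $C_{n-1}$, the $(n-1)$st Catalan number. Moreover, the permutations of length $n$ sorted to the identity by $s_{\{213,\tau\}}$ are exactly those of the form $n\rho$ (the entry $n$ followed by $\rho$), where $\rho$ is a permutation of $\{1,\dots,n-1\}$ avoiding $231$.
   Context: A sequence of distinct integers contains a permutation $\tau$ if some subsequence is order-isomorphic to $\tau$; otherwise it avoids $\tau$. For a set $T$ of permutations, the map $s_T$ is defined by: read the input permutation left to right with an initially empty stack and output; at each step, if there is a next input element and pushing it keeps the stack contents, read from top to bottom, $T$-avoiding, push it; otherwise pop the top of the stack and append it to the output; stop when input and stack are empty; the output is $s_T(\pi)$. $C_m=\frac{1}{m+1}\binom{2m}{m}$. *)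

theory Defs
  imports Complex_Main "HOL-Library.Sublist" "HOL-Combinatorics.Multiset_Permutations"
begin

text \<open>A permutation of length \<open>n\<close> is written in one-line notation, as an element of
  \<^term>\<open>permutations_of_set {1..n::nat}\<close>.\<close>

definition order_isomorphic :: "nat list \<Rightarrow> nat list \<Rightarrow> bool" where
  "order_isomorphic xs ys \<longleftrightarrow> length xs = length ys \<and>
     (\<forall>i < length xs. \<forall>j < length xs. xs ! i < xs ! j \<longleftrightarrow> ys ! i < ys ! j)"

definition contains_pattern :: "nat list \<Rightarrow> nat list \<Rightarrow> bool" where
  "contains_pattern xs \<tau> \<longleftrightarrow> (\<exists>ys. subseq ys xs \<and> order_isomorphic ys \<tau>)"

definition avoids_pattern :: "nat list \<Rightarrow> nat list \<Rightarrow> bool" where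
  "avoids_pattern xs \<tau> \<longleftrightarrow> \<not> contains_pattern xs \<tau>"

definition avoids_patterns :: "nat list \<Rightarrow> nat list set \<Rightarrow> bool" where
  "avoids_patterns xs T \<longleftrightarrow> (\<forall>\<tau>\<in>T. avoids_pattern xs \<tau>)"

text \<open>\<open>stack_run T inp st\<close> is the output still to be produced when the remaining input is \<open>inp\<close>
  and the stack, read from top to bottom, is \<open>st\<close>. In the third equation the value \<open>[]\<close> is a
  dummy for the case where neither a push nor a pop is possible; this can happen only if \<open>T\<close>
  contains a pattern of length at most 1.\<close>

fun stack_run :: "nat list set \<Rightarrow> nat list \<Rightarrow> nat list \<Rightarrow> nat list" where
  "stack_run T [] [] = []"
| "stack_run T [] (y # st) = y # stack_run T [] st"
| "stack_run T (x # inp) [] =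
     (if avoids_patterns [x] T then stack_run T inp [x] else [])"
| "stack_run T (x # inp) (y # st) =
     (if avoids_patterns (x # y # st) T then stack_run T inp (x # y # st)
      else y # stack_run T (x # inp) st)"

definition stack_map :: "nat list set \<Rightarrow> nat list \<Rightarrow> nat list" where
  "stack_map T \<pi> = stack_run T \<pi> []"

definition id_perm :: "nat \<Rightarrow> nat list" where
  "id_perm n = [1..<Suc n]"

definition sorted_perms :: "nat list set \<Rightarrow> nat \<Rightarrow> nat list set" where
  "sorted_perms T n = {\<pi> \<in> permutations_of_set {1..n}. stack_map T \<pi> = id_perm n}"

definition catalan :: "nat \<Rightarrow> real" where
  "catalan m = 1 / (real m + 1) * real ((2 * m) choose m)"

end

theory Submission
  imports Defs
begin

text \<open>The bottom entry of the stack is output last, so the first entry of a sortable permutation is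
  its maximum \<open>n\<close>. Above \<open>n\<close>, a descent of the stack creates the pattern 213, whereas an
  increasing stack avoids every non-identity pattern; hence the machine runs Knuth's stack sort
  \<open>s = stack_map {[2, 1]}\<close> on the remaining entries. If \<open>M\<close> is the maximum of \<open>us M vs\<close>, then
  \<open>s (us M vs) = s us s vs M\<close>, which is sorted if and only if \<open>s us\<close> and \<open>s vs\<close> are and no entry
  of \<open>us\<close> exceeds one of \<open>vs\<close>. Avoidance of 231 obeys the same recursion, and counting along it
  gives the Catalan recurrence.\<close>

declare One_nat_def [simp del]

section \<open>Patterns\<close>

lemma set_subseq: "subseq xs ys \<Longrightarrow> set xs \<subseteq> set ys"
  by (auto dest: list_emb_set)

lemma sorted_wrt_iff_subseq: "sorted_wrt R xs \<longleftrightarrow> (\<forall>x y. subseq [x, y] xs \<longrightarrow> R x y)"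
proof (induction xs)
  case (Cons a xs)
  have "subseq [x, y] (a # xs) \<longleftrightarrow> x = a \<and> y \<in> set xs \<or> subseq [x, y] xs" for x y
    using set_subseq[of "[x, y]" xs] by (auto simp: subseq_singleton_left)
  with Cons show ?case by auto
qed simp

lemma subseq_triple_appendE:
  assumes "subseq [x, y, z] (us @ vs)"
  obtains "subseq [x, y, z] us" | "subseq [x, y, z] vs" | "x \<in> set us" "z \<in> set vs"
proof -
  from assms obtain xs\<^sub>1 xs\<^sub>2 where split: "[x, y, z] = xs\<^sub>1 @ xs\<^sub>2"
      and sub: "subseq xs\<^sub>1 us" "subseq xs\<^sub>2 vs"
    by (auto simp: subseq_append_iff)
  from split consider "xs\<^sub>1 = [x, y, z]" | "xs\<^sub>2 = [x, y, z]" | "x \<in> set xs\<^sub>1" "z \<in> set xs\<^sub>2"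
    by (auto simp: Cons_eq_append_conv)
  then show thesis
    using sub that set_subseq by cases blast+
qed

lemma avoids_pattern_subseq:
  assumes "avoids_pattern ys \<tau>" "subseq xs ys"
  shows "avoids_pattern xs \<tau>"
  using assms subseq_order.trans unfolding avoids_pattern_def contains_pattern_def by blast

lemma short_avoids_pattern:
  assumes "length xs < length \<tau>"
  shows "avoids_pattern xs \<tau>"
  unfolding avoids_pattern_def contains_pattern_def order_isomorphic_def
  using assms list_emb_length by fastforce

lemma short_avoids_patterns:
  assumes "\<forall>\<tau>\<in>T. length xs < length \<tau>"
  shows "avoids_patterns xs T"
  using assms short_avoids_pattern by (simp add: avoids_patterns_def)

lemma avoids_patterns_singleton:
  assumes "\<forall>\<tau>\<in>T. 2 \<le> length \<tau>"
  shows "avoids_patterns [x] T"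
  using assms by (intro short_avoids_patterns) fastforce

lemma order_isomorphic_sorted_iff:
  assumes "order_isomorphic xs ys"
  shows "sorted xs \<longleftrightarrow> sorted ys"
  using assms unfolding order_isomorphic_def sorted_wrt_iff_nth_less
  by (auto simp flip: not_less)

lemma sorted_avoids_unsorted:
  assumes "sorted xs" "\<not> sorted \<tau>"
  shows "avoids_pattern xs \<tau>"
  unfolding avoids_pattern_def contains_pattern_def
proof safe
  fix ys assume "subseq ys xs" "order_isomorphic ys \<tau>"
  then have "sorted ys"
    using assms(1) subseq_order.trans unfolding sorted_wrt_iff_subseq by blast
  with \<open>order_isomorphic ys \<tau>\<close> assms(2) show False
    by (simp add: order_isomorphic_sorted_iff)
qed

lemma avoids_21_iff_sorted: "avoids_pattern xs [2, 1] \<longleftrightarrow> sorted xs"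
proof
  assume avoids: "avoids_pattern xs [2, 1]"
  have "order_isomorphic [x, y] [2, 1]" if "y < x" for x y
    using that by (auto simp: order_isomorphic_def All_less_Suc)
  with avoids show "sorted xs"
    unfolding sorted_wrt_iff_subseq avoids_pattern_def contains_pattern_def
    by (meson not_le_imp_less)
qed (simp add: sorted_avoids_unsorted)

lemma avoids_213_append_max_iff_sorted:
  assumes "\<forall>x\<in>set xs. x < b"
  shows "avoids_pattern (xs @ [b]) [2, 1, 3] \<longleftrightarrow> sorted xs"
proof
  assume avoids: "avoids_pattern (xs @ [b]) [2, 1, 3]"
  have "x \<le> y" if "subseq [x, y] xs" for x y
  proof (rule ccontr)
    assume "\<not> x \<le> y"
    moreover have "x < b"
      using that assms set_subseq by fastforce
    ultimately have "order_isomorphic [x, y, b] [2, 1, 3]"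
      by (auto simp: order_isomorphic_def All_less_Suc)
    moreover have "subseq [x, y, b] (xs @ [b])"
      using list_emb_append_mono[OF that, of "[b]" "[b]"] by simp
    ultimately show False
      using avoids by (auto simp: avoids_pattern_def contains_pattern_def)
  qed
  then show "sorted xs"
    by (simp add: sorted_wrt_iff_subseq)
next
  assume "sorted xs"
  with assms have "sorted (xs @ [b])"
    by (auto simp: sorted_append)
  then show "avoids_pattern (xs @ [b]) [2, 1, 3]"
    by (simp add: sorted_avoids_unsorted)
qed

lemma avoids_231_iff:
  "avoids_pattern xs [2, 3, 1] \<longleftrightarrow> (\<forall>x y z. subseq [x, y, z] xs \<longrightarrow> z < x \<longrightarrow> y \<le> x)"
proof -
  have "\<exists>x y z. ys = [x, y, z]" if "order_isomorphic ys [2, 3, 1]" for ys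
    using that by (auto simp: order_isomorphic_def length_Suc_conv)
  moreover have "order_isomorphic [x, y, z] [2, 3, 1] \<longleftrightarrow> z < x \<and> x < y" for x y z
    by (auto simp: order_isomorphic_def All_less_Suc)
  ultimately show ?thesis
    unfolding avoids_pattern_def contains_pattern_def by (metis not_less)
qed

lemma avoids_231_append_max_iff:
  assumes "\<forall>x\<in>set us. x < M" "\<forall>x\<in>set vs. x \<le> M"
  shows "avoids_pattern (us @ M # vs) [2, 3, 1] \<longleftrightarrow>
    avoids_pattern us [2, 3, 1] \<and> avoids_pattern vs [2, 3, 1] \<and>
    (\<forall>u\<in>set us. \<forall>v\<in>set vs. u \<le> v)" (is "?L \<longleftrightarrow> ?R")
proof
  assume ?L
  have "u \<le> v" if "u \<in> set us" "v \<in> set vs" for u v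
  proof -
    have "subseq [u, M, v] (us @ M # vs)"
      using that list_emb_append_mono[of "(=)" "[u]" us "[M, v]" "M # vs"]
      by (simp add: subseq_singleton_left)
    then have "v < u \<longrightarrow> M \<le> u"
      using \<open>?L\<close> unfolding avoids_231_iff by blast
    with that(1) assms(1) show ?thesis by auto
  qed
  moreover have "subseq us (us @ M # vs)" "subseq vs (us @ M # vs)"
    by auto
  ultimately show ?R
    using avoids_pattern_subseq[OF \<open>?L\<close>] by blast
next
  assume ?R
  then have parts: "avoids_pattern us [2, 3, 1]" "avoids_pattern vs [2, 3, 1]"
    and le: "\<forall>u\<in>set us. \<forall>v\<in>set vs. u \<le> v"
    by simp_all
  show ?L
    unfolding avoids_231_iff
  proof (intro allI impI, rule ccontr)
    fix x y z assume sub: "subseq [x, y, z] (us @ M # vs)" and "z < x" "\<not> y \<le> x"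
    then have "\<not> subseq [x, y, z] us" "\<not> subseq [x, y, z] vs"
      using parts unfolding avoids_231_iff by blast+
    with sub consider "subseq [x, y, z] (M # vs)" "\<not> subseq [x, y, z] vs"
      | "x \<in> set us" "z \<in> set (M # vs)"
      by (blast elim: subseq_triple_appendE)
    then show False
    proof cases
      case 1
      then have "x = M" "y \<in> set vs"
        using set_subseq[of "[y, z]" vs] by (auto split: if_splits)
      with assms(2) \<open>\<not> y \<le> x\<close> show False by auto
    next
      case 2
      with le assms(1) \<open>z < x\<close> show False
        by (metis set_ConsD leD less_asym)
    qed
  qed
qed

lemma id_perm_Suc: "id_perm (Suc n) = id_perm n @ [Suc n]"
  by (simp add: id_perm_def)

lemma id_perm_in_permutations: "id_perm n \<in> permutations_of_set {1..n}"
  by (auto simp: id_perm_def simp del: upt_Suc)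

lemma sorted_permutation_iff_id_perm:
  assumes "xs \<in> permutations_of_set {1..n}"
  shows "sorted xs \<longleftrightarrow> xs = id_perm n"
proof
  assume "sorted xs"
  moreover have "sorted (id_perm n)"
    by (simp add: id_perm_def del: upt_Suc)
  ultimately show "xs = id_perm n"
    using assms id_perm_in_permutations[of n]
    by (intro sorted_distinct_set_unique) (auto dest: permutations_of_setD)
qed (simp add: id_perm_def del: upt_Suc)

section \<open>The stack\<close>

lemma mset_stack_run:
  assumes "\<forall>\<tau>\<in>T. 2 \<le> length \<tau>"
  shows "mset (stack_run T inp st) = mset inp + mset st"
  using assms
proof (induction T inp st rule: stack_run.induct)
  case (3 T x inp)
  then show ?case
    by (simp add: avoids_patterns_singleton)
qed auto

lemma mset_stack_map:
  assumes "\<forall>\<tau>\<in>T. 2 \<le> length \<tau>"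
  shows "mset (stack_map T \<pi>) = mset \<pi>"
  using mset_stack_run[OF assms] by (simp add: stack_map_def)

lemma stack_map_in_permutations_iff:
  assumes "\<forall>\<tau>\<in>T. 2 \<le> length \<tau>"
  shows "stack_map T \<pi> \<in> permutations_of_set A \<longleftrightarrow> \<pi> \<in> permutations_of_set A"
  using mset_stack_map[OF assms, of \<pi>, THEN mset_eq_setD]
    mset_stack_map[OF assms, of \<pi>, THEN mset_eq_imp_distinct_iff]
  by (simp add: permutations_of_set_def)

lemma last_stack_run:
  assumes "\<forall>\<tau>\<in>T. 3 \<le> length \<tau>" "st \<noteq> []"
  shows "last (stack_run T inp st) = last st"
  using assms
proof (induction T inp st rule: stack_run.induct)
  case (2 T y st)
  then show ?case
    by (cases st) auto
next
  case (4 T x inp y st)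
  show ?case
  proof (cases "avoids_patterns (x # y # st) T")
    case True
    with 4 show ?thesis by simp
  next
    case False
    have "avoids_patterns [x, y] T"
      using "4.prems"(1) by (intro short_avoids_patterns) fastforce
    with False have "st \<noteq> []" by auto
    moreover have "\<forall>\<tau>\<in>T. 2 \<le> length \<tau>"
      using "4.prems"(1) by fastforce
    from mset_stack_run[OF this, of "x # inp" st] have "stack_run T (x # inp) st \<noteq> []"
      by auto
    ultimately show ?thesis
      using 4 False by simp
  qed
qed simp_all

lemma last_stack_map:
  assumes "\<forall>\<tau>\<in>T. 3 \<le> length \<tau>"
  shows "last (stack_map T (x # xs)) = x"
proof -
  have "avoids_patterns [x] T"
    using assms by (intro avoids_patterns_singleton) fastforce
  then show ?thesis
    by (simp add: stack_map_def last_stack_run[OF assms])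
qed

lemma stack_run_append_bottom:
  assumes "\<forall>\<sigma>\<in>U. 2 \<le> length \<sigma>"
    and "\<And>ys. set ys \<subseteq> A \<Longrightarrow> avoids_patterns (ys @ [b]) T \<longleftrightarrow> avoids_patterns ys U"
    and "set inp \<union> set st \<subseteq> A"
  shows "stack_run T inp (st @ [b]) = stack_run U inp st @ [b]"
  using assms
proof (induction U inp st rule: stack_run.induct)
  case (3 U x inp)
  have "avoids_patterns [x] U"
    using "3.prems"(1) by (rule avoids_patterns_singleton)
  moreover from this have "avoids_patterns [x, b] T"
    using "3.prems"(2)[of "[x]"] "3.prems"(3) by simp
  ultimately show ?case
    using 3 by simp
next
  case (4 U x inp y st)
  have "avoids_patterns (x # y # st @ [b]) T \<longleftrightarrow> avoids_patterns (x # y # st) U"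
    using "4.prems"(2)[of "x # y # st"] "4.prems"(3) by simp
  with 4 show ?case by simp
qed auto

lemma stack_run_append_blocked:
  assumes "\<forall>\<sigma>\<in>T. 2 \<le> length \<sigma>"
    and "\<And>y ys. y \<in> set us \<union> set st \<Longrightarrow> \<not> avoids_patterns (x # y # ys) T"
  shows "stack_run T (us @ x # vs) st = stack_run T us st @ stack_run T vs [x]"
  using assms
proof (induction T us st rule: stack_run.induct)
qed (auto simp: avoids_patterns_singleton)

section \<open>Knuth's stack sort\<close>

lemma avoids_patterns_21_iff_sorted: "avoids_patterns xs {[2, 1]} \<longleftrightarrow> sorted xs"
  by (simp add: avoids_patterns_def avoids_21_iff_sorted)

lemma stack_map_21_append_max:
  assumes "\<forall>x\<in>set us. x < M" "\<forall>x\<in>set vs. x \<le> M"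
  shows "stack_map {[2, 1]} (us @ M # vs) =
    stack_map {[2, 1]} us @ stack_map {[2, 1]} vs @ [M]"
proof -
  have "stack_run {[2, 1]} (us @ M # vs) [] =
      stack_run {[2, 1]} us [] @ stack_run {[2, 1]} vs ([] @ [M])"
    using assms(1) stack_run_append_blocked[of "{[2, 1]}" us "[]" M vs]
    by (force simp: avoids_patterns_21_iff_sorted)
  also have "stack_run {[2, 1]} vs ([] @ [M]) = stack_run {[2, 1]} vs [] @ [M]"
    using assms(2)
    by (intro stack_run_append_bottom[where A = "{..M}"])
      (auto simp: avoids_patterns_21_iff_sorted sorted_append)
  finally show ?thesis
    by (simp add: stack_map_def)
qed

lemma sorted_stack_map_21_iff_avoids_231:
  "sorted (stack_map {[2, 1]} xs) \<longleftrightarrow> avoids_pattern xs [2, 3, 1]"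
proof (induction xs rule: length_induct)
  case (1 xs)
  show ?case
  proof (cases "xs = []")
    case True
    then show ?thesis
      by (simp add: stack_map_def short_avoids_pattern)
  next
    case False
    define M where "M = Max (set xs)"
    have "M \<in> set xs" and le_M: "\<forall>x\<in>set xs. x \<le> M"
      using False by (simp_all add: M_def)
    then obtain us vs where xs: "xs = us @ M # vs" and "M \<notin> set us"
      by (meson split_list_first)
    with le_M have max: "\<forall>x\<in>set us. x < M" "\<forall>x\<in>set vs. x \<le> M"
      by (auto simp: less_le)
    have sets: "set (stack_map {[2, 1]} ys) = set ys" for ys
      by (intro mset_eq_setD mset_stack_map) simp
    have "sorted (stack_map {[2, 1]} xs) \<longleftrightarrow>
        sorted (stack_map {[2, 1]} us) \<and> sorted (stack_map {[2, 1]} vs) \<and>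
        (\<forall>u\<in>set us. \<forall>v\<in>set vs. u \<le> v)"
      unfolding xs stack_map_21_append_max[OF max]
      using max by (auto simp: sorted_append sets le_less)
    also have "\<dots> \<longleftrightarrow> avoids_pattern xs [2, 3, 1]"
      using "1.IH" unfolding xs avoids_231_append_max_iff[OF max] by simp
    finally show ?thesis .
  qed
qed

section \<open>Sorted permutations\<close>

definition avoiders :: "nat list \<Rightarrow> nat set \<Rightarrow> nat list set" where
  "avoiders \<tau> A = {xs \<in> permutations_of_set A. avoids_pattern xs \<tau>}"

lemma mem_sorted_perms_iff:
  assumes "\<forall>\<tau>\<in>T. 2 \<le> length \<tau>"
  shows "\<pi> \<in> sorted_perms T n \<longleftrightarrow> stack_map T \<pi> = id_perm n"
  using id_perm_in_permutations[of n] stack_map_in_permutations_iff[OF assms, of \<pi> "{1..n}"]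
  by (auto simp: sorted_perms_def)

lemma sorted_perms_21_eq_avoiders_231: "sorted_perms {[2, 1]} n = avoiders [2, 3, 1] {1..n}"
proof -
  have "stack_map {[2, 1]} \<pi> = id_perm n \<longleftrightarrow> avoids_pattern \<pi> [2, 3, 1]"
    if "\<pi> \<in> permutations_of_set {1..n}" for \<pi>
  proof -
    have "stack_map {[2, 1]} \<pi> \<in> permutations_of_set {1..n}"
      using that by (simp add: stack_map_in_permutations_iff)
    then show ?thesis
      by (simp add: sorted_permutation_iff_id_perm[symmetric] sorted_stack_map_21_iff_avoids_231)
  qed
  then show ?thesis
    by (auto simp: sorted_perms_def avoiders_def)
qed

lemma stack_map_insert_213_Cons_max:
  assumes "\<forall>\<sigma>\<in>S. 3 \<le> length \<sigma> \<and> \<not> sorted \<sigma>" "\<forall>x\<in>set \<rho>. x < b"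
  shows "stack_map (insert [2, 1, 3] S) (b # \<rho>) = stack_map {[2, 1]} \<rho> @ [b]"
proof -
  let ?T = "insert [2, 1, 3] S"
  have "avoids_patterns (ys @ [b]) ?T \<longleftrightarrow> sorted ys" if "set ys \<subseteq> {..<b}" for ys
  proof -
    have "avoids_pattern (ys @ [b]) [2, 1, 3] \<longleftrightarrow> sorted ys"
      using that by (intro avoids_213_append_max_iff_sorted) auto
    moreover have "avoids_pattern (ys @ [b]) \<sigma>" if "sorted ys" "\<sigma> \<in> S" for \<sigma>
      using that \<open>set ys \<subseteq> {..<b}\<close> assms(1)
      by (intro sorted_avoids_unsorted) (auto simp: sorted_append)
    ultimately show ?thesis
      by (auto simp: avoids_patterns_def)
  qed
  then have "stack_run ?T \<rho> ([] @ [b]) = stack_run {[2, 1]} \<rho> [] @ [b]"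
    using assms(2)
    by (intro stack_run_append_bottom[where A = "{..<b}"]) (auto simp: avoids_patterns_21_iff_sorted)
  moreover have "avoids_patterns [b] ?T"
    using assms(1) by (intro avoids_patterns_singleton) fastforce
  ultimately show ?thesis
    by (simp add: stack_map_def)
qed

lemma sorted_perms_insert_213_Suc:
  assumes "\<forall>\<sigma>\<in>S. 3 \<le> length \<sigma> \<and> \<not> sorted \<sigma>"
  shows "sorted_perms (insert [2, 1, 3] S) (Suc n) = (#) (Suc n) ` sorted_perms {[2, 1]} n"
proof -
  let ?T = "insert [2, 1, 3] S"
  have lengths: "\<forall>\<tau>\<in>?T. 3 \<le> length \<tau>" "\<forall>\<tau>\<in>?T. 2 \<le> length \<tau>"
    using assms by fastforce+
  have below: "\<forall>x\<in>set \<rho>. x < Suc n" if "mset \<rho> = mset (id_perm n)" for \<rho>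
    using mset_eq_setD[OF that] by (auto simp: id_perm_def simp del: upt_Suc)
  have "stack_map ?T \<pi> = id_perm (Suc n) \<longleftrightarrow>
      (\<exists>\<rho>. \<pi> = Suc n # \<rho> \<and> stack_map {[2, 1]} \<rho> = id_perm n)" (is "?L \<longleftrightarrow> ?R") for \<pi>
  proof
    assume ?L
    then have mset: "mset \<pi> = mset (id_perm n @ [Suc n])"
      using mset_stack_map[OF lengths(2), of \<pi>] by (simp add: id_perm_Suc)
    then obtain x \<rho> where \<pi>: "\<pi> = x # \<rho>"
      by (cases \<pi>) auto
    then have "x = Suc n"
      using last_stack_map[OF lengths(1), of x \<rho>] \<open>?L\<close> by (simp add: id_perm_Suc)
    moreover from this mset have "mset \<rho> = mset (id_perm n)"
      by (simp add: \<pi>)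
    ultimately show ?R
      using \<open>?L\<close> stack_map_insert_213_Cons_max[OF assms below] by (simp add: \<pi> id_perm_Suc)
  next
    assume ?R
    then obtain \<rho> where \<rho>: "\<pi> = Suc n # \<rho>" "stack_map {[2, 1]} \<rho> = id_perm n"
      by blast
    then have "mset \<rho> = mset (id_perm n)"
      using mset_stack_map[of "{[2, 1]}" \<rho>] by simp
    then show ?L
      using \<rho> stack_map_insert_213_Cons_max[OF assms below] by (simp add: id_perm_Suc)
  qed
  then show ?thesis
    using lengths(2) by (auto simp: mem_sorted_perms_iff)
qed

section \<open>Counting\<close>

lemma ordered_partition_of_intervalE:
  fixes a b :: nat
  assumes "A \<union> B = {a..<b}" "a \<le> b" "\<forall>u\<in>A. \<forall>v\<in>B. u < v"
  obtains c where "c \<in> {a..b}" "A = {a..<c}" "B = {c..<b}"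
proof -
  define c where "c = Min (insert b B)"
  have "finite B"
    using assms(1) by (metis finite_Un finite_atLeastLessThan)
  then have "c \<in> insert b B" and least: "\<forall>v\<in>insert b B. c \<le> v"
    using Min_in[of "insert b B"] by (simp_all add: c_def)
  have union: "x \<in> A \<or> x \<in> B \<longleftrightarrow> a \<le> x \<and> x < b" for x
    using assms(1) by (auto simp: set_eq_iff)
  have "c \<in> {a..b}"
    using \<open>c \<in> insert b B\<close> union[of c] assms(2) by auto
  have above: "x < c" if "x \<in> A" for x
    using that \<open>c \<in> insert b B\<close> union[of x] assms(3) by auto
  have "x \<in> A \<longleftrightarrow> a \<le> x \<and> x < c" "x \<in> B \<longleftrightarrow> c \<le> x \<and> x < b" for x
    using union[of x] above[of x] least \<open>c \<in> {a..b}\<close> by force+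
  then have "A = {a..<c}" "B = {c..<b}"
    by (simp_all add: set_eq_iff)
  with \<open>c \<in> {a..b}\<close> show thesis by (rule that)
qed

lemma append_max_in_avoiders_231_iff:
  assumes "a \<le> b"
  shows "us @ b # vs \<in> avoiders [2, 3, 1] {a..<Suc b} \<longleftrightarrow>
    (\<exists>c\<in>{a..b}. us \<in> avoiders [2, 3, 1] {a..<c} \<and> vs \<in> avoiders [2, 3, 1] {c..<b})"
    (is "?L \<longleftrightarrow> ?R")
proof
  assume ?L
  then have set: "set (us @ b # vs) = {a..<Suc b}" and distinct: "distinct (us @ b # vs)"
    and avoids: "avoids_pattern (us @ b # vs) [2, 3, 1]"
    by (simp_all add: avoiders_def permutations_of_set_def)
  have "set us \<union> set vs = set (us @ b # vs) - {b}"
    using distinct by auto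
  also have "\<dots> = {a..<b}"
    unfolding set by auto
  finally have union: "set us \<union> set vs = {a..<b}" .
  then have max: "\<forall>x\<in>set us. x < b" "\<forall>x\<in>set vs. x \<le> b"
    by (metis UnI1 UnI2 atLeastLessThan_iff less_imp_le)+
  have parts: "avoids_pattern us [2, 3, 1]" "avoids_pattern vs [2, 3, 1]"
    and "\<forall>u\<in>set us. \<forall>v\<in>set vs. u \<le> v"
    using avoids unfolding avoids_231_append_max_iff[OF max] by auto
  then have "\<forall>u\<in>set us. \<forall>v\<in>set vs. u < v"
    using distinct by (auto simp: less_le)
  then obtain c where "c \<in> {a..b}" "set us = {a..<c}" "set vs = {c..<b}"
    using ordered_partition_of_intervalE[OF union assms] by blast
  with parts distinct show ?R
    by (intro bexI[of _ c]) (auto simp: avoiders_def)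
next
  assume ?R
  then obtain c where "c \<in> {a..b}" and "set us = {a..<c}" "set vs = {c..<b}"
    and "distinct us" "distinct vs" "avoids_pattern us [2, 3, 1]" "avoids_pattern vs [2, 3, 1]"
    by (auto simp: avoiders_def permutations_of_set_def)
  moreover from this have "avoids_pattern (us @ b # vs) [2, 3, 1]"
    by (subst avoids_231_append_max_iff) auto
  ultimately show ?L
    by (auto simp: avoiders_def intro!: permutations_of_setI)
qed

lemma bij_betw_avoiders_231_split_max:
  assumes "a \<le> b"
  shows "bij_betw (\<lambda>(c, us, vs). us @ b # vs)
    (SIGMA c:{a..b}. avoiders [2, 3, 1] {a..<c} \<times> avoiders [2, 3, 1] {c..<b})
    (avoiders [2, 3, 1] {a..<Suc b})" (is "bij_betw ?f ?S ?B")
proof (rule bij_betw_imageI)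
  have recover: "c = a + length us \<and> b \<notin> set us \<and> b \<notin> set vs"
    if "c \<in> {a..b}" "us \<in> avoiders [2, 3, 1] {a..<c}" "vs \<in> avoiders [2, 3, 1] {c..<b}"
    for c us vs
    using that
    by (auto simp: avoiders_def dest: permutations_of_setD length_finite_permutations_of_set)
  show "inj_on ?f ?S"
  proof (rule inj_onI)
    fix p p' assume "p \<in> ?S" "p' \<in> ?S" "?f p = ?f p'"
    moreover obtain c us vs c' us' vs' where p: "p = (c, us, vs)" "p' = (c', us', vs')"
      by (metis prod_cases3)
    ultimately show "p = p'"
      using recover[of c us vs] recover[of c' us' vs'] by (auto simp: append_Cons_eq_iff)
  qed
  show "?f ` ?S = ?B"
  proof
    show "?f ` ?S \<subseteq> ?B"
      using append_max_in_avoiders_231_iff[OF assms] by auto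
    show "?B \<subseteq> ?f ` ?S"
    proof
      fix xs assume xs: "xs \<in> ?B"
      then have "b \<in> set xs"
        using assms by (auto simp: avoiders_def dest: permutations_of_setD)
      then obtain us vs where "xs = us @ b # vs"
        by (meson split_list)
      with xs append_max_in_avoiders_231_iff[OF assms] show "xs \<in> ?f ` ?S"
        by (auto simp: image_iff)
    qed
  qed
qed

lemma card_avoiders_231_Suc:
  assumes "a \<le> b"
  shows "card (avoiders [2, 3, 1] {a..<Suc b}) =
    (\<Sum>c=a..b. card (avoiders [2, 3, 1] {a..<c}) * card (avoiders [2, 3, 1] {c..<b}))"
proof -
  have "finite (avoiders \<tau> A)" for \<tau> A
    by (simp add: avoiders_def)
  then show ?thesis
    unfolding bij_betw_same_card[OF bij_betw_avoiders_231_split_max[OF assms], symmetric]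
    by (simp add: card_cartesian_product)
qed

lemma catalan_Suc: "(real m + 2) * catalan (Suc m) = (4 * real m + 2) * catalan m"
proof -
  have "Suc m * (2 * Suc m choose Suc m) = 2 * (Suc m * (Suc (2 * m) choose m))"
    using Suc_times_binomial[of m "Suc (2 * m)"] by simp
  also have "Suc (2 * m) choose m = Suc (2 * m) choose Suc m"
    using binomial_symmetric[of m "Suc (2 * m)"] by (simp add: Suc_diff_le)
  also have "Suc m * (Suc (2 * m) choose Suc m) = Suc (2 * m) * (2 * m choose m)"
    by (rule Suc_times_binomial)
  finally have "real (Suc m * (2 * Suc m choose Suc m)) = real (2 * (Suc (2 * m) * (2 * m choose m)))"
    by (simp only:)
  then have "(real m + 1) * real (2 * Suc m choose Suc m) = (4 * real m + 2) * real (2 * m choose m)"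
    by (simp add: algebra_simps del: mult_Suc_right binomial_Suc_Suc)
  then show ?thesis
    by (simp add: catalan_def field_simps del: mult_Suc_right binomial_Suc_Suc)
qed

lemma sum_index_times_self_convolution:
  fixes f :: "nat \<Rightarrow> 'a::comm_ring_1"
  shows "2 * (\<Sum>i\<le>m. of_nat i * (f i * f (m - i))) = of_nat m * (\<Sum>i\<le>m. f i * f (m - i))"
proof -
  let ?W = "\<Sum>i\<le>m. of_nat i * (f i * f (m - i))"
  have "?W = (\<Sum>i\<le>m. of_nat (m - i) * (f (m - i) * f (m - (m - i))))"
    by (rule sum.reindex_bij_witness[of _ "\<lambda>i. m - i" "\<lambda>i. m - i"]) auto
  also have "\<dots> = (\<Sum>i\<le>m. of_nat m * (f i * f (m - i)) - of_nat i * (f i * f (m - i)))"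
    by (intro sum.cong) (auto simp: of_nat_diff algebra_simps)
  also have "\<dots> = of_nat m * (\<Sum>i\<le>m. f i * f (m - i)) - ?W"
    by (simp add: sum_subtractf sum_distrib_left)
  finally show ?thesis
    by (simp add: algebra_simps)
qed

text \<open>With the weight \<open>i + 1\<close> the convolution for \<open>Suc m\<close> reduces to that for \<open>m\<close> by the two-term
  recurrence, and by symmetry the weight \<open>i\<close> averages to half the upper index.\<close>

lemma catalan_convolution: "(\<Sum>i\<le>m. catalan i * catalan (m - i)) = catalan (Suc m)"
proof (induction m)
  case 0
  show ?case by (simp add: catalan_def)
next
  case (Suc m)
  define S where "S m = (\<Sum>i\<le>m. catalan i * catalan (m - i))" for m
  define W where "W m = (\<Sum>i\<le>m. real i * (catalan i * catalan (m - i)))" for m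
  have W: "2 * W m = real m * S m" for m
    unfolding S_def W_def by (rule sum_index_times_self_convolution)
  have "W (Suc m) + S (Suc m) = (\<Sum>i\<le>Suc m. (real i + 1) * catalan i * catalan (Suc m - i))"
    by (simp only: W_def S_def sum.distrib[symmetric]) (simp add: algebra_simps)
  also have "\<dots> = catalan (Suc m) + (\<Sum>i\<le>m. (real i + 2) * catalan (Suc i) * catalan (m - i))"
    by (subst sum.atMost_Suc_shift) (simp add: catalan_def add.commute)
  also have "\<dots> = catalan (Suc m) + (\<Sum>i\<le>m. (4 * real i + 2) * catalan i * catalan (m - i))"
    by (simp only: catalan_Suc)
  also have "\<dots> = catalan (Suc m) + 4 * W m + 2 * S m"
    by (simp add: W_def S_def sum_distrib_left sum.distrib[symmetric] algebra_simps)
  finally have "(real m + 3) * S (Suc m) = 2 * catalan (Suc m) + (4 * real m + 4) * S m"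
    using W[of m] W[of "Suc m"] by (simp add: algebra_simps)
  also have "S m = catalan (Suc m)"
    using Suc.IH by (simp add: S_def)
  also have "2 * catalan (Suc m) + (4 * real m + 4) * catalan (Suc m) = (real m + 3) * catalan (Suc (Suc m))"
    using catalan_Suc[of "Suc m"] by (simp add: algebra_simps)
  finally have "S (Suc m) = catalan (Suc (Suc m))"
    using of_nat_0_le_iff[of m, where 'a = real] by (subst (asm) mult_left_cancel) linarith+
  then show ?case by (simp add: S_def)
qed

lemma card_avoiders_231_interval: "real (card (avoiders [2, 3, 1] {a..<b})) = catalan (b - a)"
proof (induction "b - a" arbitrary: a b rule: less_induct)
  case less
  show ?case
  proof (cases "a < b")
    case False
    have "avoiders [2, 3, 1] {} = {[]}"
      by (auto simp: avoiders_def intro: short_avoids_pattern)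
    with False show ?thesis
      by (simp add: catalan_def)
  next
    case True
    then obtain d where b: "b = Suc d" and "a \<le> d"
      by (cases b) auto
    have "real (card (avoiders [2, 3, 1] {a..<b})) =
        (\<Sum>c=a..d. real (card (avoiders [2, 3, 1] {a..<c})) * real (card (avoiders [2, 3, 1] {c..<d})))"
      by (simp add: b card_avoiders_231_Suc[OF \<open>a \<le> d\<close>])
    also have "\<dots> = (\<Sum>c=a..d. catalan (c - a) * catalan (d - c))"
    proof (intro sum.cong refl)
      fix c assume "c \<in> {a..d}"
      then show "real (card (avoiders [2, 3, 1] {a..<c})) * real (card (avoiders [2, 3, 1] {c..<d})) =
          catalan (c - a) * catalan (d - c)"
        using less[of c a] less[of d c] b by auto
    qed
    also have "\<dots> = (\<Sum>i\<le>d - a. catalan i * catalan (d - a - i))"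
      by (subst sum.atLeastAtMost_shift_0[OF \<open>a \<le> d\<close>]) (simp add: atLeast0AtMost)
    also have "\<dots> = catalan (b - a)"
      using \<open>a \<le> d\<close> catalan_convolution[of "d - a"] by (simp add: b Suc_diff_le)
    finally show ?thesis .
  qed
qed

theorem theorem3p3:
  fixes \<tau> :: "nat list" and k n :: nat
  assumes "\<tau> \<in> permutations_of_set {1..k}"
    and "k \<ge> 3"
    and "\<tau> \<noteq> id_perm k"
    and "n \<ge> 1"
  shows "real (card (sorted_perms {[2, 1, 3], \<tau>} n)) = catalan (n - 1) \<and>
    sorted_perms {[2, 1, 3], \<tau>} n =
      {n # \<rho> | \<rho>. \<rho> \<in> permutations_of_set {1..n - 1} \<and> avoids_pattern \<rho> [2, 3, 1]}"
proof -
  obtain m where n: "n = Suc m"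
    using assms(4) by (cases n) auto
  have "length \<tau> = k" "\<not> sorted \<tau>"
    using assms(1,3) by (simp_all add: length_finite_permutations_of_set sorted_permutation_iff_id_perm)
  then have eq: "sorted_perms {[2, 1, 3], \<tau>} n = (#) n ` avoiders [2, 3, 1] {1..m}"
    using assms(2) by (simp add: n sorted_perms_insert_213_Suc sorted_perms_21_eq_avoiders_231)
  then have "real (card (sorted_perms {[2, 1, 3], \<tau>} n)) = catalan m"
    using card_avoiders_231_interval[of 1 "Suc m"]
    by (simp add: card_image atLeastLessThanSuc_atLeastAtMost)
  with eq show ?thesis
    by (auto simp: n avoiders_def)
qed

end
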